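(* Let $X$ be a locally compact metric space and $\Gamma$ a pseudo*group of local homeomorphisms of $X$ which is minimal and equicontinuous. Let $X_0$ be a nonempty relatively compact open subset of $X$ and let $\Gamma_0=\{\gamma\in\Gamma\mid \mathrm{Dom}(\gamma)\cup\mathrm{Range}(\gamma)\subset X_0\}$. Then there exists a nonzero finite $\Gamma_0$-invariant Radon measure $\mu$ on $X_0$.
   Context: A local homeomorphism of $X$ is a homeomorphism $\gamma$ from an open subset $\mathrm{Dom}(\gamma)$ onto an open subset $\mathrm{Range}(\gamma)$. A pseudo*group is a set $\Gamma$ of local homeomorphisms such that: (1) if $\gamma\in\Gamma$ and $U\subset\mathrm{Dom}(\gamma)$ is open then $\gamma|_U\in\Gamma$; (2) the identity of $X$ is in $\Gamma$; (3) if $\gamma,\gamma'\in\Gamma$ and $\mathrm{Dom}(\gamma')=\mathrm{Range}(\gamma)$ then $\gamma'\circ\gamma\in\Gamma$; (4) if $\gamma\in\Gamma$ then $\gamma^{-1}\in\Gamma$ (no axiom of taking unions is assumed). $\Gamma$ is minimal if for every $x\in X$ the orbit $\{\gamma x\mid\gamma\in\Gamma, x\in\mathrm{Dom}(\gamma)\}$ is dense in $X$. $\Gamma$ is equicontinuous if for every $\epsilon>0$ there is $\delta(\epsilon)>0$ such that whenever $\gamma\in\Gamma$, $x,x'\in\mathrm{Dom}(\gamma)$ and $d(x,x')<\delta(\epsilon)$, we have $d(\gamma x,\gamma x')\le\epsilon$. A Radon measure $\mu$ on $X_0$ is $\Gamma_0$-invariant if $\mu(\zeta\circ\gamma^{-1})=\mu(\zeta)$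 for all $\gamma\in\Gamma_0$ and all compactly supported continuous $\zeta$ on $X_0$ with $\mathrm{supp}\,\zeta\subset\mathrm{Dom}(\gamma)$, where $\zeta\circ\gamma^{-1}$ is extended by $0$ outside $\mathrm{Range}(\gamma)$. *)

theory Defs
  imports "HOL-Analysis.Analysis" "HOL-Probability.Probability"
begin

definition local_homeo :: "('a::metric_space \<rightharpoonup> 'a) \<Rightarrow> bool" where
  "local_homeo \<gamma> \<longleftrightarrow> open (dom \<gamma>) \<and> open (ran \<gamma>) \<and>
     (\<exists>g. homeomorphism (dom \<gamma>) (ran \<gamma>) (\<lambda>x. the (\<gamma> x)) g)"

definition map_inv :: "('a \<rightharpoonup> 'a) \<Rightarrow> ('a \<rightharpoonup> 'a)" where
  "map_inv \<gamma> = (\<lambda>y. if y \<in> ran \<gamma> then Some (THE x. \<gamma> x = Some y) else None)"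

definition pseudo_star_group :: "('a::metric_space \<rightharpoonup> 'a) set \<Rightarrow> bool" where
  "pseudo_star_group \<Gamma> \<longleftrightarrow>
     (\<forall>\<gamma>\<in>\<Gamma>. local_homeo \<gamma>) \<and>
     (\<forall>\<gamma>\<in>\<Gamma>. \<forall>U. open U \<and> U \<subseteq> dom \<gamma> \<longrightarrow> \<gamma> |` U \<in> \<Gamma>) \<and>
     Some \<in> \<Gamma> \<and>
     (\<forall>\<gamma>\<in>\<Gamma>. \<forall>\<gamma>'\<in>\<Gamma>. dom \<gamma>' = ran \<gamma> \<longrightarrow> \<gamma>' \<circ>\<^sub>m \<gamma> \<in> \<Gamma>) \<and>
     (\<forall>\<gamma>\<in>\<Gamma>. map_inv \<gamma> \<in> \<Gamma>)"

definition orbit :: "('a \<rightharpoonup> 'a) set \<Rightarrow> 'a \<Rightarrow> 'a set" where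
  "orbit \<Gamma> x = {y. \<exists>\<gamma>\<in>\<Gamma>. \<gamma> x = Some y}"

definition minimal_pg :: "('a::metric_space \<rightharpoonup> 'a) set \<Rightarrow> bool" where
  "minimal_pg \<Gamma> \<longleftrightarrow> (\<forall>x. closure (orbit \<Gamma> x) = UNIV)"

definition equicontinuous_pg :: "('a::metric_space \<rightharpoonup> 'a) set \<Rightarrow> bool" where
  "equicontinuous_pg \<Gamma> \<longleftrightarrow> (\<forall>\<epsilon>>0. \<exists>\<delta>>0. \<forall>\<gamma>\<in>\<Gamma>. \<forall>x x'.
      x \<in> dom \<gamma> \<longrightarrow> x' \<in> dom \<gamma> \<longrightarrow> dist x x' < \<delta> \<longrightarrow>
      dist (the (\<gamma> x)) (the (\<gamma> x')) \<le> \<epsilon>)"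

definition radon_measure_on :: "'a::metric_space set \<Rightarrow> 'a measure \<Rightarrow> bool" where
  "radon_measure_on X0 M \<longleftrightarrow>
     sets M = sets (restrict_space borel X0) \<and>
     (\<forall>x\<in>X0. \<exists>U. open U \<and> x \<in> U \<and> emeasure M (U \<inter> X0) < \<infinity>) \<and>
     (\<forall>A\<in>sets M. emeasure M A = (SUP K\<in>{K. compact K \<and> K \<subseteq> A}. emeasure M K)) \<and>
     (\<forall>A\<in>sets M. emeasure M A = (INF U\<in>{U. open U \<and> A \<subseteq> U}. emeasure M (U \<inter> X0)))"

definition supp_on :: "'a::metric_space set \<Rightarrow> ('a \<Rightarrow> real) \<Rightarrow> 'a set" where
  "supp_on X0 \<zeta> = X0 \<inter> closure {x\<in>X0. \<zeta> x \<noteq> 0}"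

definition Cc_on :: "'a::metric_space set \<Rightarrow> ('a \<Rightarrow> real) set" where
  "Cc_on X0 = {\<zeta>. continuous_on X0 \<zeta> \<and> compact (supp_on X0 \<zeta>)}"

definition push_fun :: "('a \<rightharpoonup> 'a) \<Rightarrow> ('a \<Rightarrow> real) \<Rightarrow> 'a \<Rightarrow> real" where
  "push_fun \<gamma> \<zeta> = (\<lambda>y. if y \<in> ran \<gamma> then \<zeta> (the (map_inv \<gamma> y)) else 0)"

definition invariant_measure :: "('a \<rightharpoonup> 'a) set \<Rightarrow> 'a::metric_space set \<Rightarrow> 'a measure \<Rightarrow> bool" where
  "invariant_measure \<Gamma>0 X0 M \<longleftrightarrow>
     (\<forall>\<gamma>\<in>\<Gamma>0. \<forall>\<zeta>\<in>Cc_on X0. supp_on X0 \<zeta> \<subseteq> dom \<gamma> \<longrightarrow>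
        integral\<^sup>L M (push_fun \<gamma> \<zeta>) = integral\<^sup>L M \<zeta>)"

end

theory Submission
  imports Defs
begin

text \<open>
  Haar's covering construction. Let \<open>B\<^sub>r(x)\<close> be the set of all \<open>y\<close> such that
  \<open>d(\<gamma> x, \<gamma> y) \<le> r\<close> for every \<open>\<gamma> \<in> \<Gamma>\<close> defined at both points. Equicontinuity puts
  a \<open>d\<close>-ball of radius \<open>\<delta>(r)\<close> into \<open>B\<^sub>r(x)\<close>, the identity keeps \<open>B\<^sub>r(x)\<close> inside the closed
  \<open>d\<close>-ball of radius \<open>r\<close>, and \<open>\<gamma>\<close> maps \<open>B\<^sub>r(x) \<inter> Dom \<gamma>\<close> into \<open>B\<^sub>r(\<gamma> x)\<close>. Hence the number \<open>N\<^sub>r(A)\<close> of sets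
  \<open>B\<^sub>r(x)\<close> needed to cover \<open>A\<close> is \<open>\<Gamma>\<close>-invariant for small \<open>r\<close> when \<open>A\<close> is relatively compact in
  the domain. By Tychonoff, \<open>N\<^sub>r(A) / N\<^sub>r(K\<^sub>0)\<close> has, as \<open>r \<rightarrow> 0\<close>, a cluster point that is a
  subadditive set function, additive on sets at positive distance; minimality makes it finite on
  compact sets. Its outer measure by countable open covers satisfies Caratheodory's metric
  criterion, and the resulting Borel measure is restricted to \<open>X\<^sub>0\<close>.
\<close>

section \<open>Metric outer measures\<close>

text \<open>Separation is a pairwise bound, not a bound on a distance between sets, so it holds
  vacuously when \<open>A\<close> or \<open>B\<close> is empty.\<close>

locale metric_outer_measure =
  fixes \<mu> :: "'a::metric_space set \<Rightarrow> ennreal"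
  assumes empty: "\<mu> {} = 0"
    and mono: "A \<subseteq> B \<Longrightarrow> \<mu> A \<le> \<mu> B"
    and countable_subadditive: "\<mu> (\<Union>i. S i) \<le> (\<Sum>i::nat. \<mu> (S i))"
    and superadditive_separated:
      "\<lbrakk>0 < e; \<And>a b. a \<in> A \<Longrightarrow> b \<in> B \<Longrightarrow> e \<le> dist a b\<rbrakk> \<Longrightarrow> \<mu> A + \<mu> B \<le> \<mu> (A \<union> B)"
begin

lemma outer_measure_space: "outer_measure_space (Pow UNIV) \<mu>"
  by (auto simp: outer_measure_space_def positive_def increasing_def countably_subadditive_def
      empty mono countable_subadditive)

lemma subadditive: "\<mu> (A \<union> B) \<le> \<mu> A + \<mu> B"
proof -
  have "\<mu> (A \<union> B) = \<mu> (\<Union>i. binaryset A B i)"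
    by (simp add: UN_binaryset_eq)
  also have "\<dots> \<le> (\<Sum>i. \<mu> (binaryset A B i))"
    by (rule countable_subadditive)
  also have "\<dots> = \<mu> A + \<mu> B"
    by (rule suminf_binaryset_eq) (rule empty)
  finally show ?thesis .
qed

text \<open>Every other shell around \<open>F\<close> is separated from the previous ones, which bounds their total
  mass and makes the mass close to \<open>F\<close> negligible.\<close>

lemma closed_caratheodory:
  assumes F: "closed F"
  shows "\<mu> (T \<inter> F) + \<mu> (T - F) \<le> \<mu> T"
proof (cases "F = {} \<or> \<mu> T = \<infinity>")
  case True
  then show ?thesis
    by (auto simp: empty)
next
  case False
  define s where "s n = 1 / real (Suc n)" for n
  have s_pos: "0 < s n" for n
    by (simp add: s_def)
  have s_antimono: "s n \<le> s m" if "m \<le> n" for m n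
    using that by (simp add: s_def frac_le)
  have s_Suc: "s (Suc n) < s n" for n
    by (simp add: s_def frac_less2)
  define D where "D n = {x\<in>T. s n \<le> infdist x F}" for n
  define R where "R n = {x\<in>T. s (Suc n) \<le> infdist x F \<and> infdist x F < s n}" for n
  have cover: "T - F \<subseteq> D n \<union> (\<Union>k. R (k + n))" for n
  proof
    fix x assume x: "x \<in> T - F"
    then have pos: "0 < infdist x F"
      using F False by (metis DiffD2 in_closed_iff_infdist_zero infdist_nonneg less_eq_real_def)
    show "x \<in> D n \<union> (\<Union>k. R (k + n))"
    proof (cases "s n \<le> infdist x F")
      case True
      then show ?thesis
        using x by (simp add: D_def)
    next
      case far: False
      define m where "m = (LEAST m. s m \<le> infdist x F)"
      have ex: "\<exists>m. s m \<le> infdist x F"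
        using reals_Archimedean[OF pos] by (auto simp: s_def inverse_eq_divide intro: less_imp_le)
      then have m: "s m \<le> infdist x F"
        unfolding m_def by (rule LeastI_ex)
      have "n < m"
        using far m s_antimono[of m n] by force
      then obtain k where k: "m = Suc (k + n)"
        by (metis add.commute less_iff_Suc_add)
      have "\<not> s (k + n) \<le> infdist x F"
        by (rule not_less_Least) (simp add: k flip: m_def)
      then have "x \<in> R (k + n)"
        using x m k by (simp add: R_def)
      then show ?thesis
        by blast
    qed
  qed
  have shells: "(\<Sum>k<n. \<mu> (R (2 * k + c))) \<le> \<mu> (\<Union>k<n. R (2 * k + c))" for n c
  proof (induction n)
    case 0
    then show ?case by simp
  next
    case (Suc n)
    have "(\<Sum>k<Suc n. \<mu> (R (2 * k + c))) \<le> \<mu> (\<Union>k<n. R (2 * k + c)) + \<mu> (R (2 * n + c))"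
      using Suc by (simp add: add_right_mono)
    also have "\<dots> \<le> \<mu> ((\<Union>k<n. R (2 * k + c)) \<union> R (2 * n + c))"
    proof (cases n)
      case 0
      then show ?thesis by (simp add: empty)
    next
      case (Suc n')
      show ?thesis
      proof (rule superadditive_separated)
        \<comment> \<open>The gap is the width of the skipped shell
          \<open>R (2 * n' + c + 1)\<close>, which lies between the earlier shells and
          \<open>R (2 * n + c)\<close>.\<close>
        show "0 < s (2 * n' + c + 1) - s (2 * n' + c + 2)"
          using s_Suc[of "2 * n' + c + 1"] by simp
        fix a b assume a: "a \<in> (\<Union>k<n. R (2 * k + c))" and b: "b \<in> R (2 * n + c)"
        from a obtain k where k: "k \<le> n'" "a \<in> R (2 * k + c)"
          using Suc by (auto simp: less_Suc_eq_le)
        have "s (2 * n' + c + 1) \<le> s (Suc (2 * k + c))"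
          using k by (intro s_antimono) simp
        then have "s (2 * n' + c + 1) \<le> infdist a F"
          using k by (simp add: R_def)
        moreover have "infdist b F < s (2 * n' + c + 2)"
          using b Suc by (simp add: R_def)
        moreover have "infdist a F \<le> infdist b F + dist a b"
          by (rule infdist_triangle)
        ultimately show "s (2 * n' + c + 1) - s (2 * n' + c + 2) \<le> dist a b"
          by linarith
      qed
    qed
    also have "(\<Union>k<n. R (2 * k + c)) \<union> R (2 * n + c) = (\<Union>k<Suc n. R (2 * k + c))"
      by (auto simp: lessThan_Suc)
    finally show ?case .
  qed
  have shells_T: "(\<Sum>k<n. \<mu> (R (2 * k + c))) \<le> \<mu> T" for n c
    by (rule order_trans[OF shells mono]) (auto simp: R_def)
  have "(\<Sum>k<n. \<mu> (R k)) \<le> \<mu> T + \<mu> T" for n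
  proof -
    have "(\<Sum>k<n. \<mu> (R k)) \<le> (\<Sum>k<2 * n. \<mu> (R k))"
      by (rule sum_mono2) auto
    also have "\<dots> = (\<Sum>k<n. \<mu> (R (2 * k + 0))) + (\<Sum>k<n. \<mu> (R (2 * k + 1)))"
      by (induction n) (simp_all add: ac_simps)
    also have "\<dots> \<le> \<mu> T + \<mu> T"
      by (intro add_mono shells_T)
    finally show ?thesis .
  qed
  then have "(\<Sum>k. \<mu> (R k)) \<le> \<mu> T + \<mu> T"
    by (intro suminf_le_const) auto
  then have fin: "(\<Sum>k. \<mu> (R k)) \<noteq> \<infinity>"
    using False by (auto simp: top_unique)
  \<comment> \<open>Finiteness of the total makes the truncated subtraction of
    \<open>ennreal\<close> a genuine one, so the tails are what remains after the partial sums and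
    tend to 0.\<close>
  have "(\<Sum>k. \<mu> (R (k + n))) = (\<Sum>k. \<mu> (R k)) - (\<Sum>k<n. \<mu> (R k))" for n
  proof -
    have "(\<Sum>k. \<mu> (R k)) = (\<Sum>k. \<mu> (R (k + n))) + (\<Sum>k<n. \<mu> (R k))"
      by (rule suminf_offset) simp
    then show ?thesis
      using fin by simp
  qed
  moreover have "(\<lambda>n. (\<Sum>k. \<mu> (R k)) - (\<Sum>k<n. \<mu> (R k))) \<longlonglongrightarrow> (\<Sum>k. \<mu> (R k)) - (\<Sum>k. \<mu> (R k))"
    using fin by (intro tendsto_diff_ennreal tendsto_const summable_LIMSEQ) auto
  ultimately have tail: "(\<lambda>n. \<Sum>k. \<mu> (R (k + n))) \<longlonglongrightarrow> 0"
    using fin by simp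
  have "\<mu> (T \<inter> F) + \<mu> (T - F) \<le> \<mu> T + (\<Sum>k. \<mu> (R (k + n)))" for n
  proof -
    have "\<mu> (T - F) \<le> \<mu> (D n \<union> (\<Union>k. R (k + n)))"
      by (rule mono[OF cover])
    also have "\<dots> \<le> \<mu> (D n) + (\<Sum>k. \<mu> (R (k + n)))"
      by (rule order_trans[OF subadditive add_left_mono[OF countable_subadditive]])
    finally have "\<mu> (T \<inter> F) + \<mu> (T - F) \<le> \<mu> (T \<inter> F) + \<mu> (D n) + (\<Sum>k. \<mu> (R (k + n)))"
      by (metis add.assoc add_left_mono)
    also have "\<mu> (T \<inter> F) + \<mu> (D n) \<le> \<mu> ((T \<inter> F) \<union> D n)"
    proof (rule superadditive_separated[OF s_pos])
      fix a b assume "a \<in> T \<inter> F" "b \<in> D n"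
      then show "s n \<le> dist a b"
        using infdist_le[of a F b] by (auto simp: D_def dist_commute)
    qed
    also have "\<mu> ((T \<inter> F) \<union> D n) \<le> \<mu> T"
      by (rule mono) (auto simp: D_def)
    finally show ?thesis
      by (simp add: add_right_mono)
  qed
  then have "\<mu> (T \<inter> F) + \<mu> (T - F) \<le> \<mu> T + 0"
    by (intro tendsto_le[OF _ tendsto_add[OF tendsto_const tail] tendsto_const]) auto
  then show ?thesis
    by simp
qed

section \<open>The Borel measure of a metric outer measure\<close>

definition borel_measure :: "'a measure" where
  "borel_measure = measure_of UNIV (sets borel) \<mu>"

lemma sets_borel_measure [simp, measurable_cong]: "sets borel_measure = sets borel"
  using sets.sigma_sets_eq[of "borel :: 'a measure"] by (simp add: borel_measure_def)

lemma space_borel_measure [simp]: "space borel_measure = UNIV"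
  by (simp add: borel_measure_def)

text \<open>The Caratheodory-measurable sets form a sigma-algebra, so it suffices to test the closed
  sets, which generate the Borel sets.\<close>

lemma sets_borel_caratheodory: "sets borel \<subseteq> lambda_system UNIV (Pow UNIV) \<mu>"
proof -
  interpret P: sigma_algebra UNIV "Pow UNIV :: 'a set set"
    by (rule sigma_algebra_Pow)
  interpret L: sigma_algebra UNIV "lambda_system UNIV (Pow UNIV) \<mu>"
    using P.caratheodory_lemma[OF outer_measure_space] by (simp add: measure_space_def)
  have "F \<in> lambda_system UNIV (Pow UNIV) \<mu>" if "closed F" for F
    unfolding P.lambda_system_eq
  proof (intro CollectI conjI ballI antisym)
    fix T
    show "\<mu> (T \<inter> F) + \<mu> (T - F) \<le> \<mu> T"
      by (rule closed_caratheodory[OF that])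
    show "\<mu> T \<le> \<mu> (T \<inter> F) + \<mu> (T - F)"
      using subadditive[of "T \<inter> F" "T - F"] by (simp add: Int_Diff_Un)
  qed simp
  then have "sigma_sets UNIV (Collect closed) \<subseteq> lambda_system UNIV (Pow UNIV) \<mu>"
    by (intro L.sigma_sets_subset) auto
  then show ?thesis
    by (simp add: borel_eq_closed)
qed

lemma emeasure_borel_measure:
  assumes "A \<in> sets borel"
  shows "emeasure borel_measure A = \<mu> A"
proof (rule emeasure_measure_of[OF borel_measure_def])
  interpret P: sigma_algebra UNIV "Pow UNIV :: 'a set set"
    by (rule sigma_algebra_Pow)
  have "countably_additive (lambda_system UNIV (Pow UNIV) \<mu>) \<mu>"
    using P.caratheodory_lemma[OF outer_measure_space] by (simp add: measure_space_def)
  then show "countably_additive (sets borel_measure) \<mu>"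
    using sets_borel_caratheodory unfolding countably_additive_def sets_borel_measure by blast
qed (use assms in \<open>auto simp: positive_def empty\<close>)

end

section \<open>Outer measures from contents\<close>

text \<open>These are the properties of covering numbers that survive the limit: each involves
  finitely many sets only. Countable subadditivity is supplied afterwards by passing to an outer
  measure.\<close>

locale metric_content =
  fixes \<kappa> :: "'a::metric_space set \<Rightarrow> ennreal"
  assumes content_empty: "\<kappa> {} = 0"
    and content_mono: "A \<subseteq> B \<Longrightarrow> \<kappa> A \<le> \<kappa> B"
    and content_subadditive: "\<kappa> (A \<union> B) \<le> \<kappa> A + \<kappa> B"
    and content_superadditive_separated:
      "\<lbrakk>0 < e; \<And>a b. a \<in> A \<Longrightarrow> b \<in> B \<Longrightarrow> e \<le> dist a b\<rbrakk> \<Longrightarrow> \<kappa> A + \<kappa> B \<le> \<kappa> (A \<union> B)"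
begin

lemma content_finite_UN: "finite I \<Longrightarrow> \<kappa> (\<Union>i\<in>I. A i) \<le> (\<Sum>i\<in>I. \<kappa> (A i))"
proof (induction I rule: finite_induct)
  case empty
  then show ?case by (simp add: content_empty)
next
  case (insert i I)
  then show ?case
    using order_trans[OF content_subadditive[of "A i" "\<Union>i\<in>I. A i"] add_left_mono] by auto
qed

text \<open>Covering by open sets serves two ends: compact sets admit finite subcovers, which keeps
  the outer measure above the content there, and outer regularity comes from the covers
  themselves.\<close>

definition outer :: "'a set \<Rightarrow> ennreal" where
  "outer A = (INF U\<in>{U :: nat \<Rightarrow> 'a set. (\<forall>i. open (U i)) \<and> A \<subseteq> (\<Union>i. U i)}. \<Sum>i. \<kappa> (U i))"

lemma outer_le: "(\<And>i. open (U i)) \<Longrightarrow> A \<subseteq> (\<Union>i. U i) \<Longrightarrow> outer A \<le> (\<Sum>i. \<kappa> (U i))"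
  unfolding outer_def by (rule INF_lower) auto

lemma outer_geI:
  "(\<And>U. (\<And>i. open (U i)) \<Longrightarrow> A \<subseteq> (\<Union>i. U i) \<Longrightarrow> c \<le> (\<Sum>i. \<kappa> (U i))) \<Longrightarrow> c \<le> outer A"
  unfolding outer_def by (rule INF_greatest) auto

lemma outer_lessE:
  assumes "outer A < c"
  obtains U where "\<And>i. open (U i)" "A \<subseteq> (\<Union>i. U i)" "(\<Sum>i. \<kappa> (U i)) < c"
  using assms unfolding outer_def INF_less_iff by auto

lemma outer_le_content:
  assumes "open U" "A \<subseteq> U"
  shows "outer A \<le> \<kappa> U"
proof -
  have "outer A \<le> (\<Sum>i. \<kappa> (binaryset U {} i))"
    using assms by (intro outer_le) (auto simp: binaryset_def UN_binaryset_eq)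
  also have "\<dots> = \<kappa> U"
    by (subst suminf_binaryset_eq) (simp_all add: content_empty)
  finally show ?thesis .
qed

text \<open>Compactness reduces a countable open cover to a finite one, for which finite
  subadditivity is enough. This is what later keeps the measure from being zero.\<close>

lemma content_le_outer:
  assumes "compact K"
  shows "\<kappa> K \<le> outer K"
proof (rule outer_geI)
  fix U :: "nat \<Rightarrow> 'a set"
  assume U: "\<And>i. open (U i)" "K \<subseteq> (\<Union>i. U i)"
  obtain I where I: "finite I" "K \<subseteq> (\<Union>i\<in>I. U i)"
    using compactE_image[OF assms, of UNIV U] U by auto
  have "\<kappa> K \<le> \<kappa> (\<Union>i\<in>I. U i)"
    by (rule content_mono[OF I(2)])
  also have "\<dots> \<le> (\<Sum>i\<in>I. \<kappa> (U i))"
    by (rule content_finite_UN[OF I(1)])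
  also have "\<dots> \<le> (\<Sum>i. \<kappa> (U i))"
    by (rule sum_le_suminf) (simp_all add: I)
  finally show "\<kappa> K \<le> (\<Sum>i. \<kappa> (U i))" .
qed

sublocale metric_outer_measure outer
proof
  show "outer {} = 0"
    using outer_le_content[of "{}" "{}"] by (simp add: content_empty)
  show "outer A \<le> outer B" if "A \<subseteq> B" for A B
    using that by (intro outer_geI outer_le) auto
  show "outer (\<Union>i. A i) \<le> (\<Sum>i. outer (A i))" for A :: "nat \<Rightarrow> 'a set"
  proof (rule ennreal_le_epsilon)
    fix e :: real assume fin: "(\<Sum>i. outer (A i)) < top" and e: "0 < e"
    \<comment> \<open>Finiteness of \<open>outer (A i)\<close> leaves room for a strict excess; the
      excesses chosen here add up to \<open>e\<close>.\<close>
    have "\<exists>U. (\<forall>j. open (U j)) \<and> A i \<subseteq> (\<Union>j. U j) \<and>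
        (\<Sum>j. \<kappa> (U j)) < outer (A i) + ennreal (e * (1/2)^Suc i)" for i
    proof -
      have "outer (A i) < top"
        using fin by (rule ennreal_suminf_lessD)
      then have "outer (A i) < outer (A i) + ennreal (e * (1/2)^Suc i)"
        using e by (simp add: ennreal_add_left_cancel_less)
      then obtain U :: "nat \<Rightarrow> 'a set" where "\<And>j. open (U j)" "A i \<subseteq> (\<Union>j. U j)"
        "(\<Sum>j. \<kappa> (U j)) < outer (A i) + ennreal (e * (1/2)^Suc i)"
        by (rule outer_lessE) blast
      then show ?thesis
        by blast
    qed
    then obtain U where U: "\<And>i j. open (U i j)" "\<And>i. A i \<subseteq> (\<Union>j. U i j)"
      "\<And>i. (\<Sum>j. \<kappa> (U i j)) < outer (A i) + ennreal (e * (1/2)^Suc i)"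
      by metis
    define V where "V n = U (fst (prod_decode n)) (snd (prod_decode n))" for n
    have "outer (\<Union>i. A i) \<le> (\<Sum>n. \<kappa> (V n))"
    proof (rule outer_le)
      show "(\<Union>i. A i) \<subseteq> (\<Union>n. V n)"
      proof
        fix x assume "x \<in> (\<Union>i. A i)"
        then obtain i j where "x \<in> U i j"
          using U(2) by blast
        then have "x \<in> V (prod_encode (i, j))"
          by (simp add: V_def)
        then show "x \<in> (\<Union>n. V n)"
          by blast
      qed
    qed (simp add: V_def U)
    also have "\<dots> = (\<Sum>i. \<Sum>j. \<kappa> (U i j))"
      by (subst suminf_ennreal_2dimen[where f="\<lambda>(i, j). \<kappa> (U i j)" and g="\<lambda>i. \<Sum>j. \<kappa> (U i j)", symmetric])
        (simp_all add: V_def o_def case_prod_beta)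
    also have "\<dots> \<le> (\<Sum>i. outer (A i) + ennreal (e * (1/2)^Suc i))"
      by (intro suminf_le less_imp_le U(3)) auto
    also have "\<dots> = (\<Sum>i. outer (A i)) + (\<Sum>i. ennreal (e * (1/2)^Suc i))"
      by (rule suminf_add[symmetric]) auto
    also have "(\<Sum>i. ennreal (e * (1/2)^Suc i)) = ennreal e"
      using sums_mult[OF power_half_series, of e] e by (intro suminf_ennreal_eq) auto
    finally show "outer (\<Union>i. A i) \<le> (\<Sum>i. outer (A i)) + ennreal e" .
  qed
  show "outer A + outer B \<le> outer (A \<union> B)"
    if e: "0 < e" and sep: "\<And>a b. a \<in> A \<Longrightarrow> b \<in> B \<Longrightarrow> e \<le> dist a b" for A B and e :: real
  proof (rule outer_geI)
    fix U :: "nat \<Rightarrow> 'a set"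
    assume U: "\<And>i. open (U i)" "A \<union> B \<subseteq> (\<Union>i. U i)"
    \<comment> \<open>Thickening by \<open>e/4\<close> gives open sets still at distance
      \<open>e/2\<close>. Cutting every member of a cover of \<open>A \<union> B\<close> by them
      yields separate open covers of \<open>A\<close> and \<open>B\<close>, and the separation
      property of the content applies to each member.\<close>
    define A' where "A' = (\<Union>a\<in>A. ball a (e/4))"
    define B' where "B' = (\<Union>b\<in>B. ball b (e/4))"
    have sep': "e/2 \<le> dist x y" if "x \<in> A'" "y \<in> B'" for x y
    proof -
      from that obtain a b where ab: "a \<in> A" "b \<in> B" "dist a x < e/4" "dist b y < e/4"
        by (auto simp: A'_def B'_def)
      moreover have "dist a b \<le> dist a x + dist x y + dist b y"
        by metric
      ultimately show ?thesis
        using sep[of a b] by linarith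
    qed
    have "A \<subseteq> A'" "B \<subseteq> B'" "open A'" "open B'"
      using e by (auto simp: A'_def B'_def)
    then have "outer A + outer B \<le> (\<Sum>i. \<kappa> (U i \<inter> A')) + (\<Sum>i. \<kappa> (U i \<inter> B'))"
      using U by (intro add_mono outer_le open_Int) auto
    also have "\<dots> = (\<Sum>i. \<kappa> (U i \<inter> A') + \<kappa> (U i \<inter> B'))"
      by (rule suminf_add) auto
    also have "\<dots> \<le> (\<Sum>i. \<kappa> (U i))"
    proof (intro suminf_le)
      fix i
      have "\<kappa> (U i \<inter> A') + \<kappa> (U i \<inter> B') \<le> \<kappa> (U i \<inter> A' \<union> U i \<inter> B')"
        using e sep' by (intro content_superadditive_separated[of "e/2"]) auto
      also have "\<dots> \<le> \<kappa> (U i)"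
        by (rule content_mono) auto
      finally show "\<kappa> (U i \<inter> A') + \<kappa> (U i \<inter> B') \<le> \<kappa> (U i)" .
    qed auto
    finally show "outer A + outer B \<le> (\<Sum>i. \<kappa> (U i))" .
  qed
qed

section \<open>Regularity of the measure of a content\<close>

lemma outer_regular:
  assumes A: "A \<in> sets borel"
  shows "emeasure borel_measure A = (INF U\<in>{U. open U \<and> A \<subseteq> U}. emeasure borel_measure U)"
proof (rule antisym)
  show "emeasure borel_measure A \<le> (INF U\<in>{U. open U \<and> A \<subseteq> U}. emeasure borel_measure U)"
    by (auto intro!: INF_greatest emeasure_mono)
  \<comment> \<open>The union of an open cover is one of the competing open sets, and its measure is
    at most the sum of the contents.\<close>
  have "(INF U\<in>{U. open U \<and> A \<subseteq> U}. emeasure borel_measure U) \<le> outer A"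
  proof (rule outer_geI)
    fix U :: "nat \<Rightarrow> 'a set"
    assume U: "\<And>i. open (U i)" "A \<subseteq> (\<Union>i. U i)"
    have "emeasure borel_measure (\<Union>i. U i) = outer (\<Union>i. U i)"
      using U by (intro emeasure_borel_measure borel_open) auto
    also have "\<dots> \<le> (\<Sum>i. \<kappa> (U i))"
      using U by (intro outer_le) auto
    finally show "(INF U\<in>{U. open U \<and> A \<subseteq> U}. emeasure borel_measure U) \<le> (\<Sum>i. \<kappa> (U i))"
      using U by (intro INF_lower2[of "\<Union>i. U i"]) auto
  qed
  then show "(INF U\<in>{U. open U \<and> A \<subseteq> U}. emeasure borel_measure U) \<le> emeasure borel_measure A"
    by (simp add: emeasure_borel_measure A)
qed

text \<open>Outer regularity is applied to the complement: if an open \<open>U\<close> contains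
  \<open>C - A\<close> with little excess, then \<open>C - U\<close> is a compact subset of
  \<open>A\<close> that misses only \<open>A \<inter> U\<close>. Finiteness allows the mass of
  \<open>C - A\<close> to be cancelled.\<close>

lemma inner_regular:
  assumes A: "A \<in> sets borel" and C: "compact C" "A \<subseteq> C" and fin: "emeasure borel_measure UNIV < \<infinity>"
  shows "emeasure borel_measure A = (SUP K\<in>{K. compact K \<and> K \<subseteq> A}. emeasure borel_measure K)"
proof (rule antisym)
  let ?\<mu> = "emeasure borel_measure"
  have fin': "?\<mu> B < \<infinity>" for B
    using emeasure_mono[of B UNIV borel_measure] fin by (auto simp: less_top[symmetric] top_unique)
  show "(SUP K\<in>{K. compact K \<and> K \<subseteq> A}. ?\<mu> K) \<le> ?\<mu> A"
    using A by (auto intro!: SUP_least emeasure_mono)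
  show "?\<mu> A \<le> (SUP K\<in>{K. compact K \<and> K \<subseteq> A}. ?\<mu> K)"
  proof (rule ennreal_le_epsilon)
    fix e :: real assume e: "0 < e"
    have CA: "C - A \<in> sets borel"
      using A borel_closed[OF compact_imp_closed[OF C(1)]] by (rule sets.Diff[rotated])
    have "?\<mu> (C - A) < ?\<mu> (C - A) + ennreal e"
      using fin'[of "C - A"] e by (simp add: ennreal_add_left_cancel_less)
    then obtain U where U: "open U" "C - A \<subseteq> U" "?\<mu> U < ?\<mu> (C - A) + ennreal e"
      using outer_regular[OF CA] by (auto simp: INF_less_iff)
    have "?\<mu> (A \<inter> U) + ?\<mu> (C - A) = ?\<mu> (A \<inter> U \<union> (C - A))"
      using A CA U(1) by (intro plus_emeasure) auto
    also have "\<dots> \<le> ?\<mu> U"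
      using U by (intro emeasure_mono) auto
    also have "\<dots> \<le> ennreal e + ?\<mu> (C - A)"
      using U(3) by (simp add: add.commute)
    finally have AU: "?\<mu> (A \<inter> U) \<le> ennreal e"
      using fin'[of "C - A"] by auto
    have CU: "C - U \<in> sets borel"
      using C U by (intro borel_closed compact_imp_closed compact_diff)
    have "?\<mu> A \<le> ?\<mu> ((C - U) \<union> (A \<inter> U))"
      using A C U CU by (intro emeasure_mono) auto
    also have "\<dots> \<le> ?\<mu> (C - U) + ?\<mu> (A \<inter> U)"
      using A U CU by (intro emeasure_subadditive) auto
    also have "\<dots> \<le> (SUP K\<in>{K. compact K \<and> K \<subseteq> A}. ?\<mu> K) + ennreal e"
      using AU U C by (intro add_mono SUP_upper) (auto intro: compact_diff)
    finally show "?\<mu> A \<le> (SUP K\<in>{K. compact K \<and> K \<subseteq> A}. ?\<mu> K) + ennreal e" .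
  qed
qed

end

section \<open>Covering numbers of equicontinuous pseudo*groups\<close>

lemma compact_UNIV_fun_ennreal: "compact (UNIV :: ('i \<Rightarrow> ennreal) set)"
proof -
  have "compactin (product_topology (\<lambda>i::'i. euclidean :: ennreal topology) UNIV) (PiE UNIV (\<lambda>i. UNIV))"
    unfolding compactin_PiE by (simp add: compact_UNIV)
  then show ?thesis
    by (simp add: euclidean_product_topology)
qed

text \<open>The index type will be the sets of points, so the product may be uncountable and a
  convergent subsequence cannot be expected. A cluster point suffices, because it inherits every
  closed condition that holds eventually.\<close>

lemma ennreal_fun_cluster_point:
  fixes f :: "nat \<Rightarrow> 'i \<Rightarrow> ennreal"
  obtains g where "\<And>S. closed S \<Longrightarrow> eventually (\<lambda>n. f n \<in> S) sequentially \<Longrightarrow> g \<in> S"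
proof -
  obtain g where g: "inf (nhds g) (filtermap f sequentially) \<noteq> bot"
    using compact_UNIV_fun_ennreal[where 'i='i] unfolding compact_filter
    by (auto dest!: spec[of _ "filtermap f sequentially"] simp: filtermap_bot_iff)
  show thesis
  proof (rule that[of g], rule ccontr)
    fix S assume S: "closed S" "eventually (\<lambda>n. f n \<in> S) sequentially" "g \<notin> S"
    have "eventually (\<lambda>h. h \<in> - S) (nhds g)"
      using S by (intro eventually_nhds_in_open) auto
    moreover have "eventually (\<lambda>h. h \<in> S) (filtermap f sequentially)"
      using S by (simp add: eventually_filtermap)
    ultimately have "eventually (\<lambda>h. False) (inf (nhds g) (filtermap f sequentially))"
      unfolding eventually_inf by (intro exI[of _ "\<lambda>h. h \<in> - S"] exI[of _ "\<lambda>h. h \<in> S"]) auto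
    then show False
      using g by (simp add: trivial_limit_def)
  qed
qed

lemma locally_compact_UNIV_compact_neighbourhood:
  fixes K :: "'a::metric_space set"
  assumes lc: "locally compact (UNIV :: 'a set)" and K: "compact K" "K \<subseteq> W" "open W"
  obtains V L where "open V" "compact L" "K \<subseteq> V" "V \<subseteq> L" "L \<subseteq> W"
proof -
  have "\<exists>U L. open U \<and> compact L \<and> x \<in> U \<and> U \<subseteq> L \<and> L \<subseteq> W" if "x \<in> K" for x
    using lc K that unfolding locally_def by (auto simp: subset_iff)
  then obtain U L where UL: "\<And>x. x \<in> K \<Longrightarrow> open (U x) \<and> compact (L x) \<and> x \<in> U x \<and> U x \<subseteq> L x \<and> L x \<subseteq> W"
    by metis
  obtain I where I: "I \<subseteq> K" "finite I" "K \<subseteq> (\<Union>x\<in>I. U x)"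
    using compactE_image[OF K(1), of K U] UL by blast
  show thesis
  proof
    show "open (\<Union>x\<in>I. U x)" "compact (\<Union>x\<in>I. L x)" "K \<subseteq> (\<Union>x\<in>I. U x)"
      "(\<Union>x\<in>I. U x) \<subseteq> (\<Union>x\<in>I. L x)" "(\<Union>x\<in>I. L x) \<subseteq> W"
      using UL I by blast+
  qed
qed

section \<open>Local homeomorphisms and their inverses\<close>

lemma local_homeo_inj: "local_homeo \<gamma> \<Longrightarrow> \<gamma> x = Some z \<Longrightarrow> \<gamma> y = Some z \<Longrightarrow> x = y"
  unfolding local_homeo_def homeomorphism_def by (metis domI option.sel)

lemma local_homeo_continuous: "local_homeo \<gamma> \<Longrightarrow> continuous_on (dom \<gamma>) (\<lambda>x. the (\<gamma> x))"
  unfolding local_homeo_def homeomorphism_def by blast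

lemma map_inv_eq_Some_iff:
  assumes "local_homeo \<gamma>"
  shows "map_inv \<gamma> y = Some x \<longleftrightarrow> \<gamma> x = Some y"
proof
  assume "\<gamma> x = Some y"
  moreover from this have "(THE x. \<gamma> x = Some y) = x"
    using local_homeo_inj[OF assms] by (intro the_equality) auto
  ultimately show "map_inv \<gamma> y = Some x"
    by (auto simp: map_inv_def ran_def)
next
  assume *: "map_inv \<gamma> y = Some x"
  then obtain x' where x': "\<gamma> x' = Some y"
    by (auto simp: map_inv_def ran_def split: if_splits)
  moreover from this have "(THE x. \<gamma> x = Some y) = x'"
    using local_homeo_inj[OF assms] by (intro the_equality) auto
  ultimately show "\<gamma> x = Some y"
    using * by (simp add: map_inv_def split: if_splits)
qed

lemma dom_map_inv: "dom (map_inv \<gamma>) = ran \<gamma>"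
  by (auto simp: map_inv_def split: if_splits)

lemma ran_map_inv: "local_homeo \<gamma> \<Longrightarrow> ran (map_inv \<gamma>) = dom \<gamma>"
  by (auto simp: ran_def map_inv_eq_Some_iff)

lemma map_inv_image_image:
  assumes "local_homeo \<gamma>" "A \<subseteq> dom \<gamma>"
  shows "(\<lambda>y. the (map_inv \<gamma> y)) ` (\<lambda>x. the (\<gamma> x)) ` A = A"
proof -
  have "the (map_inv \<gamma> (the (\<gamma> x))) = x" if "x \<in> A" for x
    using that assms map_inv_eq_Some_iff[OF assms(1)] by (metis domD option.sel subsetD)
  then show ?thesis
    by force
qed

lemma local_homeo_open_vimage:
  assumes "local_homeo \<gamma>" "open U"
  shows "open {x\<in>dom \<gamma>. the (\<gamma> x) \<in> U}"
proof -
  have "open ((\<lambda>x. the (\<gamma> x)) -` U \<inter> dom \<gamma>)"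
    using assms local_homeo_continuous[OF assms(1)]
    by (simp add: continuous_on_open_vimage local_homeo_def)
  then show ?thesis
    by (simp add: Collect_conj_eq vimage_def Int_commute)
qed

text \<open>The image under \<open>\<gamma>\<close> is the preimage under
  \<open>map_inv \<gamma>\<close>, which is continuous on its open domain.\<close>

lemma local_homeo_open_image:
  assumes \<gamma>: "local_homeo \<gamma>" "local_homeo (map_inv \<gamma>)" and U: "open U" "U \<subseteq> dom \<gamma>"
  shows "open ((\<lambda>x. the (\<gamma> x)) ` U)"
proof -
  have "(\<lambda>x. the (\<gamma> x)) ` U = {y\<in>dom (map_inv \<gamma>). the (map_inv \<gamma> y) \<in> U}"
  proof (intro set_eqI iffI)
    fix y assume "y \<in> (\<lambda>x. the (\<gamma> x)) ` U"
    then obtain x where "x \<in> U" "\<gamma> x = Some y"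
      using U by fastforce
    then show "y \<in> {y\<in>dom (map_inv \<gamma>). the (map_inv \<gamma> y) \<in> U}"
      using map_inv_eq_Some_iff[OF \<gamma>(1), of y x] by auto
  next
    fix y assume "y \<in> {y\<in>dom (map_inv \<gamma>). the (map_inv \<gamma> y) \<in> U}"
    then obtain x where "x \<in> U" "map_inv \<gamma> y = Some x"
      by auto
    then show "y \<in> (\<lambda>x. the (\<gamma> x)) ` U"
      using map_inv_eq_Some_iff[OF \<gamma>(1), of y x] by force
  qed
  then show ?thesis
    using local_homeo_open_vimage[OF \<gamma>(2) U(1)] by simp
qed

section \<open>Pseudo*groups and their covering numbers\<close>

context
  fixes \<Gamma> :: "('a::metric_space \<rightharpoonup> 'a) set"
  assumes psg: "pseudo_star_group \<Gamma>"
begin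

lemma psg_local_homeo: "\<gamma> \<in> \<Gamma> \<Longrightarrow> local_homeo \<gamma>"
  and psg_restrict: "\<gamma> \<in> \<Gamma> \<Longrightarrow> open U \<Longrightarrow> U \<subseteq> dom \<gamma> \<Longrightarrow> \<gamma> |` U \<in> \<Gamma>"
  and psg_Some: "Some \<in> \<Gamma>"
  and psg_comp: "\<gamma> \<in> \<Gamma> \<Longrightarrow> \<gamma>' \<in> \<Gamma> \<Longrightarrow> dom \<gamma>' = ran \<gamma> \<Longrightarrow> \<gamma>' \<circ>\<^sub>m \<gamma> \<in> \<Gamma>"
  and psg_map_inv: "\<gamma> \<in> \<Gamma> \<Longrightarrow> map_inv \<gamma> \<in> \<Gamma>"
  using psg unfolding pseudo_star_group_def by blast+

text \<open>The composition axiom asks for \<open>dom \<gamma>' = ran \<gamma>\<close>. Cutting both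
  maps down to the points where they can be composed achieves this and does not change
  \<open>\<gamma>' \<circ>\<^sub>m \<gamma>\<close>, which is undefined elsewhere anyway.\<close>

lemma psg_comp_partial:
  assumes \<gamma>: "\<gamma> \<in> \<Gamma>" and \<gamma>': "\<gamma>' \<in> \<Gamma>"
  shows "\<gamma>' \<circ>\<^sub>m \<gamma> \<in> \<Gamma>"
proof -
  define U where "U = {x\<in>dom \<gamma>. the (\<gamma> x) \<in> dom \<gamma>'}"
  define V where "V = ran \<gamma> \<inter> dom \<gamma>'"
  have "open (dom \<gamma>')" "open (ran \<gamma>)"
    using \<gamma> \<gamma>' psg_local_homeo by (auto simp: local_homeo_def)
  then have "open U" "open V"
    unfolding U_def V_def using psg_local_homeo[OF \<gamma>] by (auto intro: local_homeo_open_vimage)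
  then have "\<gamma> |` U \<in> \<Gamma>" "\<gamma>' |` V \<in> \<Gamma>"
    using \<gamma> \<gamma>' by (auto intro!: psg_restrict simp: U_def V_def)
  moreover have "dom (\<gamma>' |` V) = ran (\<gamma> |` U)"
    by (force simp: U_def V_def ran_def restrict_map_def split: if_splits)
  ultimately have "\<gamma>' |` V \<circ>\<^sub>m \<gamma> |` U \<in> \<Gamma>"
    by (intro psg_comp)
  also have "\<gamma>' |` V \<circ>\<^sub>m \<gamma> |` U = \<gamma>' \<circ>\<^sub>m \<gamma>"
    by (rule ext) (auto simp: U_def V_def map_comp_def restrict_map_def ran_def domIff split: option.splits)
  finally show ?thesis .
qed

text \<open>Not the balls of a metric: two points are compared only by those \<open>\<gamma>\<close> whose domain contains
  both, which destroys the triangle inequality but makes the family exactly \<open>\<Gamma>\<close>-invariant.\<close>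

definition gball :: "real \<Rightarrow> 'a \<Rightarrow> 'a set" where
  "gball r x = {y. \<forall>\<gamma>\<in>\<Gamma>. x \<in> dom \<gamma> \<longrightarrow> y \<in> dom \<gamma> \<longrightarrow> dist (the (\<gamma> x)) (the (\<gamma> y)) \<le> r}"

text \<open>Without a finite cover the infimum is over the empty set and equals infinity. Centres
  may lie anywhere in the space, which makes monotonicity in \<open>A\<close> immediate.\<close>

definition covering_number :: "real \<Rightarrow> 'a set \<Rightarrow> ennreal" where
  "covering_number r A =
     (INF F\<in>{F. finite F \<and> A \<subseteq> (\<Union>x\<in>F. gball r x)}. of_nat (card F))"

lemma gball_dist: "y \<in> gball r x \<Longrightarrow> dist x y \<le> r"
  using psg_Some unfolding gball_def by fastforce

text \<open>Any \<open>\<gamma>'\<close> that tests the two image points yields the test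
  \<open>\<gamma>' \<circ>\<^sub>m \<gamma>\<close> of the original points, and this composite again
  lies in \<open>\<Gamma>\<close>.\<close>

lemma gball_image:
  assumes \<gamma>: "\<gamma> \<in> \<Gamma>" and "x \<in> dom \<gamma>" "y \<in> dom \<gamma>" "y \<in> gball r x"
  shows "the (\<gamma> y) \<in> gball r (the (\<gamma> x))"
  unfolding gball_def
proof (intro CollectI ballI impI)
  fix \<gamma>' assume \<gamma>': "\<gamma>' \<in> \<Gamma>" "the (\<gamma> x) \<in> dom \<gamma>'" "the (\<gamma> y) \<in> dom \<gamma>'"
  have "dist (the ((\<gamma>' \<circ>\<^sub>m \<gamma>) x)) (the ((\<gamma>' \<circ>\<^sub>m \<gamma>) y)) \<le> r"
    using assms \<gamma>' psg_comp_partial[OF \<gamma> \<gamma>'(1)] unfolding gball_def by auto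
  then show "dist (the (\<gamma>' (the (\<gamma> x)))) (the (\<gamma>' (the (\<gamma> y)))) \<le> r"
    using assms by auto
qed

lemma covering_number_le:
  "finite F \<Longrightarrow> A \<subseteq> (\<Union>x\<in>F. gball r x) \<Longrightarrow> covering_number r A \<le> of_nat (card F)"
  unfolding covering_number_def by (rule INF_lower) auto

lemma covering_number_geI:
  "(\<And>F. finite F \<Longrightarrow> A \<subseteq> (\<Union>x\<in>F. gball r x) \<Longrightarrow> c \<le> of_nat (card F)) \<Longrightarrow> c \<le> covering_number r A"
  unfolding covering_number_def by (rule INF_greatest) auto

lemma covering_number_empty: "covering_number r {} = 0"
  using covering_number_le[of "{}" "{}"] by simp

lemma covering_number_ge_1: "A \<noteq> {} \<Longrightarrow> 1 \<le> covering_number r A"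
proof (rule covering_number_geI)
  fix F assume "A \<noteq> {}" "finite F" "A \<subseteq> (\<Union>x\<in>F. gball r x)"
  then have "1 \<le> card F"
    by (simp add: Suc_le_eq card_gt_0_iff) auto
  then show "(1::ennreal) \<le> of_nat (card F)"
    using of_nat_mono[where 'a=ennreal] by fastforce
qed

lemma covering_number_mono: "A \<subseteq> B \<Longrightarrow> covering_number r A \<le> covering_number r B"
  by (intro covering_number_geI covering_number_le) auto

lemma covering_number_attained:
  assumes "covering_number r A \<noteq> \<infinity>"
  obtains F where "finite F" "A \<subseteq> (\<Union>x\<in>F. gball r x)" "covering_number r A = of_nat (card F)"
proof -
  let ?P = "\<lambda>F. finite F \<and> A \<subseteq> (\<Union>x\<in>F. gball r x)"
  obtain F0 where F0: "?P F0"
  proof (rule ccontr)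
    assume "\<not> thesis"
    then have "{F. ?P F} = {}"
      using that by blast
    then show False
      using assms unfolding covering_number_def by simp
  qed
  obtain F where F: "?P F" "\<And>G. ?P G \<Longrightarrow> card F \<le> card G"
    using ex_has_least_nat[of ?P F0 card, OF F0] by auto
  have "of_nat (card F) \<le> covering_number r A"
    by (intro covering_number_geI of_nat_mono F(2) conjI)
  with F(1) show thesis
    by (intro that[of F] antisym covering_number_le) auto
qed

lemma covering_number_Un: "covering_number r (A \<union> B) \<le> covering_number r A + covering_number r B"
proof (cases "covering_number r A = \<infinity> \<or> covering_number r B = \<infinity>")
  case False
  obtain F where F: "finite F" "A \<subseteq> (\<Union>x\<in>F. gball r x)" "covering_number r A = of_nat (card F)"
    using covering_number_attained[of r A] False by blast
  obtain G where G: "finite G" "B \<subseteq> (\<Union>x\<in>G. gball r x)" "covering_number r B = of_nat (card G)"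
    using covering_number_attained[of r B] False by blast
  have "covering_number r (A \<union> B) \<le> of_nat (card (F \<union> G))"
    using F G by (intro covering_number_le) auto
  also have "\<dots> \<le> of_nat (card F + card G)"
    by (intro of_nat_mono card_Un_le)
  finally show ?thesis
    using F G by simp
qed auto

text \<open>Each \<open>gball r x\<close> lies within distance \<open>r\<close> of its centre, so
  none meets both \<open>A\<close> and \<open>B\<close>. The centres of a cover of the union thus
  contain disjoint sets of centres for \<open>A\<close> and for \<open>B\<close>.\<close>

lemma covering_number_separated:
  assumes sep: "\<And>a b. a \<in> A \<Longrightarrow> b \<in> B \<Longrightarrow> 2 * r < dist a b"
  shows "covering_number r A + covering_number r B \<le> covering_number r (A \<union> B)"
proof (rule covering_number_geI)
  fix F assume F: "finite F" "A \<union> B \<subseteq> (\<Union>x\<in>F. gball r x)"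
  define FA where "FA = {x\<in>F. gball r x \<inter> A \<noteq> {}}"
  define FB where "FB = {x\<in>F. gball r x \<inter> B \<noteq> {}}"
  have "FA \<inter> FB = {}"
  proof (rule ccontr)
    assume "FA \<inter> FB \<noteq> {}"
    then obtain x a b where "a \<in> A" "b \<in> B" "a \<in> gball r x" "b \<in> gball r x"
      by (auto simp: FA_def FB_def)
    then show False
      using sep[of a b] gball_dist[of a r x] gball_dist[of b r x] dist_triangle3[of a b x]
      by simp
  qed
  have "covering_number r A + covering_number r B \<le> of_nat (card FA) + of_nat (card FB)"
    using F by (intro add_mono covering_number_le) (fastforce simp: FA_def FB_def)+
  also have "\<dots> = of_nat (card (FA \<union> FB))"
    using F \<open>FA \<inter> FB = {}\<close> by (subst card_Un_disjoint) (auto simp: FA_def FB_def)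
  also have "\<dots> \<le> of_nat (card F)"
    using F by (intro of_nat_mono card_mono) (auto simp: FA_def FB_def)
  finally show "covering_number r A + covering_number r B \<le> of_nat (card F)" .
qed

text \<open>Centres whose sets miss \<open>A\<close> are discarded. The others are within
  \<open>r\<close> of \<open>A\<close>, so by the margin assumed around \<open>A\<close> they lie in
  \<open>dom \<gamma>\<close> and can be moved by \<open>\<gamma>\<close>.\<close>

lemma covering_number_image:
  assumes \<gamma>: "\<gamma> \<in> \<Gamma>" and A: "A \<subseteq> dom \<gamma>" "\<And>a. a \<in> A \<Longrightarrow> cball a r \<subseteq> dom \<gamma>"
  shows "covering_number r ((\<lambda>x. the (\<gamma> x)) ` A) \<le> covering_number r A"
proof (rule covering_number_geI)
  fix F assume F: "finite F" "A \<subseteq> (\<Union>x\<in>F. gball r x)"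
  define F' where "F' = {x\<in>F. gball r x \<inter> A \<noteq> {}}"
  have F': "F' \<subseteq> dom \<gamma>"
  proof
    fix x assume "x \<in> F'"
    then obtain a where "a \<in> A" "a \<in> gball r x"
      by (auto simp: F'_def)
    then have "x \<in> cball a r"
      using gball_dist[of a r x] by (simp add: dist_commute)
    then show "x \<in> dom \<gamma>"
      using A \<open>a \<in> A\<close> by blast
  qed
  have "covering_number r ((\<lambda>x. the (\<gamma> x)) ` A) \<le> of_nat (card ((\<lambda>x. the (\<gamma> x)) ` F'))"
  proof (rule covering_number_le)
    show "(\<lambda>x. the (\<gamma> x)) ` A \<subseteq> (\<Union>x\<in>(\<lambda>x. the (\<gamma> x)) ` F'. gball r x)"
    proof
      fix y assume "y \<in> (\<lambda>x. the (\<gamma> x)) ` A"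
      then obtain a where a: "a \<in> A" "y = the (\<gamma> a)"
        by blast
      then obtain x where "x \<in> F" "a \<in> gball r x"
        using F by blast
      then have "x \<in> F'"
        using a by (auto simp: F'_def)
      then show "y \<in> (\<Union>x\<in>(\<lambda>x. the (\<gamma> x)) ` F'. gball r x)"
        using gball_image[OF \<gamma>, of x a r] F' A a \<open>a \<in> gball r x\<close> by blast
    qed
  qed (use F in \<open>auto simp: F'_def\<close>)
  also have "\<dots> \<le> of_nat (card F)"
    using F by (intro of_nat_mono order_trans[OF card_image_le card_mono]) (auto simp: F'_def)
  finally show "covering_number r ((\<lambda>x. the (\<gamma> x)) ` A) \<le> of_nat (card F)" .
qed

lemma covering_number_finite:
  assumes "equicontinuous_pg \<Gamma>" "0 < r" "compact K"
  shows "covering_number r K < \<infinity>"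
proof -
  obtain \<delta> where \<delta>: "0 < \<delta>" "\<And>\<gamma> x x'. \<lbrakk>\<gamma> \<in> \<Gamma>; x \<in> dom \<gamma>; x' \<in> dom \<gamma>; dist x x' < \<delta>\<rbrakk> \<Longrightarrow>
      dist (the (\<gamma> x)) (the (\<gamma> x')) \<le> r"
    using assms unfolding equicontinuous_pg_def by meson
  \<comment> \<open>The modulus \<open>\<delta>\<close> is uniform over \<open>\<Gamma>\<close>,
    hence it bounds all the tests that define \<open>gball\<close> at once.\<close>
  then have ball: "ball x \<delta> \<subseteq> gball r x" for x
    unfolding gball_def by (intro subsetI CollectI ballI impI \<delta>(2)) auto
  obtain F where "F \<subseteq> K" "finite F" "K \<subseteq> (\<Union>x\<in>F. ball x \<delta>)"
    using compactE_image[OF assms(3), of K "\<lambda>x. ball x \<delta>"] \<delta>(1) by force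
  then have "covering_number r K \<le> of_nat (card F)"
    using ball by (intro covering_number_le) blast+
  then show ?thesis
    by (rule le_less_trans) (simp add: of_nat_less_top)
qed

section \<open>Invariant contents\<close>

lemma invariant_metric_content:
  assumes eq: "equicontinuous_pg \<Gamma>" and K0: "compact K0" "K0 \<noteq> {}"
  obtains \<kappa> where "metric_content \<kappa>" "\<kappa> K0 = 1"
    "\<And>\<gamma> K A. \<lbrakk>\<gamma> \<in> \<Gamma>; compact K; K \<subseteq> dom \<gamma>; A \<subseteq> K\<rbrakk> \<Longrightarrow> \<kappa> ((\<lambda>x. the (\<gamma> x)) ` A) \<le> \<kappa> A"
proof -
  define s where "s n = inverse (real (Suc n))" for n
  have s_pos: "0 < s n" for n
    by (simp add: s_def)
  have s_small: "eventually (\<lambda>n. s n < e) sequentially" if "0 < e" for e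
    using LIMSEQ_inverse_real_of_nat that unfolding s_def by (rule order_tendstoD)
  \<comment> \<open>Normalising by the count for \<open>K0\<close>, which is finite and at least 1,
    fixes the value 1 on \<open>K0\<close> and keeps it in the limit.\<close>
  define f where "f n A = covering_number (s n) A / covering_number (s n) K0" for n A
  obtain \<kappa> where "\<And>S. closed S \<Longrightarrow> eventually (\<lambda>n. f n \<in> S) sequentially \<Longrightarrow> \<kappa> \<in> S"
    using ennreal_fun_cluster_point[of f] by blast
  then have \<kappa>: "P \<kappa>" if "closed {g. P g}" "eventually (\<lambda>n. P (f n)) sequentially" for P
    using that by fastforce
  \<comment> \<open>Each condition concerns finitely many coordinates of \<open>g\<close> and
    coordinate projections are continuous, so all of them pass to the cluster point.\<close>
  have Un: "closed {g :: 'a set \<Rightarrow> ennreal. g A + g B \<le> g C}" "closed {g :: 'a set \<Rightarrow> ennreal. g C \<le> g A + g B}"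
    and le: "closed {g :: 'a set \<Rightarrow> ennreal. g A \<le> g B}"
    and const: "closed {g :: 'a set \<Rightarrow> ennreal. g A = c}" for A B C c
    by (intro closed_Collect_le closed_Collect_eq continuous_on_add continuous_on_const
        continuous_on_product_coordinates)+
  show thesis
  proof
    show "metric_content \<kappa>"
    proof
      show "\<kappa> {} = 0"
        by (rule \<kappa>[OF const]) (simp add: f_def covering_number_empty)
      show "\<kappa> A \<le> \<kappa> B" if "A \<subseteq> B" for A B
        by (rule \<kappa>[OF le])
          (use that in \<open>simp add: f_def divide_right_mono_ennreal covering_number_mono\<close>)
      show "\<kappa> (A \<union> B) \<le> \<kappa> A + \<kappa> B" for A B
        by (rule \<kappa>[OF Un(2)])
          (simp add: f_def divide_right_mono_ennreal covering_number_Un flip: add_divide_distrib_ennreal)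
      show "\<kappa> A + \<kappa> B \<le> \<kappa> (A \<union> B)"
        if e: "0 < e" and sep: "\<And>a b. a \<in> A \<Longrightarrow> b \<in> B \<Longrightarrow> e \<le> dist a b" for A B and e :: real
      proof (rule \<kappa>[OF Un(1)], rule eventually_mono)
        show "eventually (\<lambda>n. s n < e / 2) sequentially"
          using e by (intro s_small) simp
        fix n assume n: "s n < e / 2"
        have "2 * s n < dist a b" if "a \<in> A" "b \<in> B" for a b
          using n sep[OF that] by simp
        then show "f n A + f n B \<le> f n (A \<union> B)"
          unfolding f_def add_divide_distrib_ennreal[symmetric]
          by (intro divide_right_mono_ennreal covering_number_separated)
      qed
    qed
    show "\<kappa> K0 = 1"
    proof (rule \<kappa>[OF const], rule always_eventually, rule allI)
      fix n
      have "covering_number (s n) K0 < \<infinity>"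
        by (rule covering_number_finite[OF eq s_pos K0(1)])
      moreover have "covering_number (s n) K0 \<noteq> 0"
        using covering_number_ge_1[OF K0(2), of "s n"] by auto
      ultimately show "f n K0 = 1"
        by (simp add: f_def)
    qed
    fix \<gamma> K A assume \<gamma>: "\<gamma> \<in> \<Gamma>" and K: "compact K" "K \<subseteq> dom \<gamma>" and A: "A \<subseteq> K"
    have "open (dom \<gamma>)"
      using psg_local_homeo[OF \<gamma>] by (simp add: local_homeo_def)
    \<comment> \<open>Compactness of \<open>K\<close> gives a uniform margin inside
      \<open>dom \<gamma>\<close>; once \<open>s n\<close> is below it, the covering numbers
      themselves do not increase under \<open>\<gamma>\<close>.\<close>
    then obtain e where e: "0 < e" "(\<Union>x\<in>K. cball x e) \<subseteq> dom \<gamma>"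
      using compact_subset_open_imp_cball_epsilon_subset[OF K(1) _ K(2)] by blast
    show "\<kappa> ((\<lambda>x. the (\<gamma> x)) ` A) \<le> \<kappa> A"
    proof (rule \<kappa>[OF le], rule eventually_mono[OF s_small[OF e(1)]])
      fix n assume "s n < e"
      then have "cball a (s n) \<subseteq> dom \<gamma>" if "a \<in> A" for a
        using e(2) A that subset_cball[of "s n" e a] by (meson UN_subset_iff less_imp_le order_trans subsetD)
      then show "f n ((\<lambda>x. the (\<gamma> x)) ` A) \<le> f n A"
        unfolding f_def using \<gamma> K A
        by (intro divide_right_mono_ennreal covering_number_image) auto
    qed
  qed
qed

lemma compact_image_psg:
  assumes "\<gamma> \<in> \<Gamma>" "compact K" "K \<subseteq> dom \<gamma>"
  shows "compact ((\<lambda>x. the (\<gamma> x)) ` K)" "(\<lambda>x. the (\<gamma> x)) ` K \<subseteq> ran \<gamma>"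
proof -
  show "compact ((\<lambda>x. the (\<gamma> x)) ` K)"
    using assms local_homeo_continuous[OF psg_local_homeo[OF assms(1)]]
    by (blast intro: compact_continuous_image continuous_on_subset)
  show "(\<lambda>x. the (\<gamma> x)) ` K \<subseteq> ran \<gamma>"
    using assms(3) by (force intro: ranI)
qed

text \<open>The inverse map satisfies the same inequality on the image of \<open>K\<close>, which is
  compact in its domain. Keeping \<open>\<phi>\<close> and \<open>\<Delta>\<close> general lets this
  serve both the content under \<open>\<Gamma>\<close> and the outer measure under the maps inside
  \<open>X0\<close>.\<close>

lemma image_invariant_if_nonincreasing:
  fixes \<phi> :: "'a set \<Rightarrow> ennreal"
  assumes "\<Delta> \<subseteq> \<Gamma>" and inv: "\<And>\<gamma>. \<gamma> \<in> \<Delta> \<Longrightarrow> map_inv \<gamma> \<in> \<Delta>"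
    and le: "\<And>\<gamma> K A. \<lbrakk>\<gamma> \<in> \<Delta>; compact K; K \<subseteq> dom \<gamma>; A \<subseteq> K\<rbrakk> \<Longrightarrow> \<phi> ((\<lambda>x. the (\<gamma> x)) ` A) \<le> \<phi> A"
    and \<gamma>: "\<gamma> \<in> \<Delta>" and K: "compact K" "K \<subseteq> dom \<gamma>" "A \<subseteq> K"
  shows "\<phi> ((\<lambda>x. the (\<gamma> x)) ` A) = \<phi> A"
proof (rule antisym)
  have "\<gamma> \<in> \<Gamma>"
    using assms by blast
  have "\<phi> ((\<lambda>y. the (map_inv \<gamma> y)) ` (\<lambda>x. the (\<gamma> x)) ` A) \<le> \<phi> ((\<lambda>x. the (\<gamma> x)) ` A)"
    using compact_image_psg[OF \<open>\<gamma> \<in> \<Gamma>\<close> K(1,2)] K(3)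
    by (intro le[OF inv[OF \<gamma>]]) (auto simp: dom_map_inv)
  also have "(\<lambda>y. the (map_inv \<gamma> y)) ` (\<lambda>x. the (\<gamma> x)) ` A = A"
    using K psg_local_homeo[OF \<open>\<gamma> \<in> \<Gamma>\<close>] by (intro map_inv_image_image) auto
  finally show "\<phi> A \<le> \<phi> ((\<lambda>x. the (\<gamma> x)) ` A)" .
qed (rule le[OF \<gamma> K])

text \<open>By minimality some element of \<open>\<Gamma>\<close> moves a given point into
  \<open>U\<close>. A small neighbourhood of the point is carried into \<open>U\<close> too, so by
  invariance its content is at most that of \<open>U\<close>; finitely many such neighbourhoods
  cover \<open>C\<close>.\<close>

lemma invariant_content_finite:
  assumes lc: "locally compact (UNIV :: 'a set)" and min: "minimal_pg \<Gamma>"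
    and \<kappa>: "metric_content \<kappa>"
    and le: "\<And>\<gamma> K A. \<lbrakk>\<gamma> \<in> \<Gamma>; compact K; K \<subseteq> dom \<gamma>; A \<subseteq> K\<rbrakk> \<Longrightarrow> \<kappa> ((\<lambda>x. the (\<gamma> x)) ` A) \<le> \<kappa> A"
    and U: "open U" "U \<noteq> {}" "\<kappa> U < \<infinity>" and C: "compact C"
  shows "\<kappa> C < \<infinity>"
proof -
  interpret metric_content \<kappa> by (rule \<kappa>)
  have "\<exists>V. open V \<and> x \<in> V \<and> \<kappa> V \<le> \<kappa> U" for x
  proof -
    have "orbit \<Gamma> x \<inter> U \<noteq> {}"
      using min U open_Int_closure_eq_empty[of U "orbit \<Gamma> x"] by (auto simp: minimal_pg_def)
    then obtain \<gamma> y where \<gamma>: "\<gamma> \<in> \<Gamma>" "\<gamma> x = Some y" "y \<in> U"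
      by (auto simp: orbit_def)
    define W where "W = {x\<in>dom \<gamma>. the (\<gamma> x) \<in> U}"
    have W: "open W" "x \<in> W" "W \<subseteq> dom \<gamma>"
      using \<gamma> U local_homeo_open_vimage[OF psg_local_homeo[OF \<gamma>(1)]] by (auto simp: W_def)
    obtain V L where VL: "open V" "compact L" "{x} \<subseteq> V" "V \<subseteq> L" "L \<subseteq> W"
      using locally_compact_UNIV_compact_neighbourhood[OF lc, of "{x}" W] W by auto
    have "\<kappa> V = \<kappa> ((\<lambda>x. the (\<gamma> x)) ` V)"
      using VL W \<gamma>(1) psg_map_inv le
      by (intro image_invariant_if_nonincreasing[symmetric, of \<Gamma> _ _ L]) auto
    also have "\<dots> \<le> \<kappa> U"
      using VL by (intro content_mono) (auto simp: W_def)
    finally show ?thesis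
      using VL by auto
  qed
  then obtain V where V: "\<And>x. open (V x)" "\<And>x. x \<in> V x" "\<And>x. \<kappa> (V x) \<le> \<kappa> U"
    by metis
  obtain I where I: "finite I" "C \<subseteq> (\<Union>x\<in>I. V x)"
    using compactE_image[OF C, of C V] V by (metis UN_iff subsetI)
  have "\<kappa> C \<le> (\<Sum>x\<in>I. \<kappa> (V x))"
    using I by (intro order_trans[OF content_mono content_finite_UN]) auto
  also have "\<dots> < \<infinity>"
    using V(3) U(3) by (auto simp: I intro: le_less_trans)
  finally show ?thesis .
qed

text \<open>Both integrals live on compact sets: the support \<open>K\<close> and its image. Between
  these \<open>\<gamma>\<close> is a homeomorphism carrying one restricted measure to the other, so
  the claim is a change of variables.\<close>

lemma integral_push_fun_eq:
  assumes \<gamma>: "\<gamma> \<in> \<Gamma>" "dom \<gamma> \<union> ran \<gamma> \<subseteq> X0"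
    and \<zeta>: "\<zeta> \<in> Cc_on X0" "supp_on X0 \<zeta> \<subseteq> dom \<gamma>"
    and N: "sets N = sets borel" and X0: "X0 \<in> sets borel"
    and inv: "\<And>A. A \<in> sets borel \<Longrightarrow> A \<subseteq> supp_on X0 \<zeta> \<Longrightarrow> (\<lambda>x. the (\<gamma> x)) ` A \<in> sets borel \<Longrightarrow>
      emeasure N ((\<lambda>x. the (\<gamma> x)) ` A) = emeasure N A"
  shows "integral\<^sup>L (restrict_space N X0) (push_fun \<gamma> \<zeta>) = integral\<^sup>L (restrict_space N X0) \<zeta>"
proof -
  define g where "g x = the (\<gamma> x)" for x
  define h where "h y = the (map_inv \<gamma> y)" for y
  define K where "K = supp_on X0 \<zeta>"
  have sp[simp]: "space N = UNIV"
    using sets_eq_imp_space_eq[OF N] by simp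
  note lh = psg_local_homeo[OF \<gamma>(1)] and lh' = psg_local_homeo[OF psg_map_inv[OF \<gamma>(1)]]
  have K: "compact K" "K \<subseteq> dom \<gamma>" "K \<subseteq> X0"
    using \<zeta> by (auto simp: K_def Cc_on_def supp_on_def)
  have gK: "compact (g ` K)" "g ` K \<subseteq> ran \<gamma>"
    unfolding g_def using compact_image_psg[OF \<gamma>(1) K(1,2)] by auto
  have meas: "K \<in> sets borel" "g ` K \<in> sets borel"
    using K(1) gK(1) by (auto intro!: borel_closed compact_imp_closed)
  have hg: "h (g x) = x" "g x \<in> ran \<gamma>" if "x \<in> dom \<gamma>" for x
    using that map_inv_eq_Some_iff[OF lh, of "g x" x] by (auto simp: h_def g_def intro: ranI)
  have gh: "g (h y) = y" "h y \<in> dom \<gamma>" if y: "y \<in> ran \<gamma>" for y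
  proof -
    obtain x where "\<gamma> x = Some y"
      using y by (auto simp: ran_def)
    then show "g (h y) = y" "h y \<in> dom \<gamma>"
      using map_inv_eq_Some_iff[OF lh, of y x] by (auto simp: h_def g_def)
  qed
  have cont_g: "continuous_on K g"
    unfolding g_def using local_homeo_continuous[OF lh] K(2) by (rule continuous_on_subset)
  have cont_h: "continuous_on (g ` K) h"
    unfolding h_def using local_homeo_continuous[OF lh'] gK(2)
    by (auto simp: dom_map_inv intro: continuous_on_subset)
  have push: "push_fun \<gamma> \<zeta> y = (if y \<in> ran \<gamma> then \<zeta> (h y) else 0)" for y
    by (simp add: push_fun_def h_def)
  have zero: "\<zeta> x = 0" if "x \<in> X0 - K" for x
    using that closure_subset[of "{x\<in>X0. \<zeta> x \<noteq> 0}"] by (auto simp: K_def supp_on_def)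
  \<comment> \<open>Outside \<open>ran \<gamma>\<close> the value is the default 0; inside, the
    preimage lies in \<open>X0 - K\<close>, where \<open>\<zeta>\<close> vanishes.\<close>
  have push_zero: "push_fun \<gamma> \<zeta> y = 0" if "y \<notin> g ` K" for y
  proof (cases "y \<in> ran \<gamma>")
    case True
    then have "h y \<in> X0 - K"
      using gh[OF True] that \<gamma>(2) by (metis DiffI UnCI image_eqI subsetD)
    then show ?thesis
      by (simp add: push zero)
  qed (simp add: push)
  have sets_eq: "sets (restrict_space N S) = sets (restrict_space borel S)" for S
    by (simp add: sets_restrict_space N)
  have g_meas: "g \<in> measurable (restrict_space N K) (restrict_space N (g ` K))"
    using borel_measurable_continuous_on_restrict[OF cont_g]
    by (auto simp: measurable_cong_sets[OF sets_eq sets_eq] space_restrict_space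
        intro!: measurable_restrict_space2)
  have "continuous_on (g ` K) (\<lambda>y. \<zeta> (h y))"
  proof (rule continuous_on_compose2[OF _ cont_h])
    show "continuous_on X0 \<zeta>"
      using \<zeta>(1) by (simp add: Cc_on_def)
    show "h ` g ` K \<subseteq> X0"
      using K(2,3) hg(1) by force
  qed
  then have "(\<lambda>y. \<zeta> (h y)) \<in> borel_measurable (restrict_space borel (g ` K))"
    by (rule borel_measurable_continuous_on_restrict)
  also have "?this \<longleftrightarrow> push_fun \<gamma> \<zeta> \<in> borel_measurable (restrict_space borel (g ` K))"
    using gK(2) by (intro measurable_cong) (auto simp: space_restrict_space push)
  finally have push_meas: "push_fun \<gamma> \<zeta> \<in> borel_measurable (restrict_space N (g ` K))"
    by (simp add: measurable_cong_sets[OF sets_eq refl])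
  have "integral\<^sup>L (restrict_space N X0) (push_fun \<gamma> \<zeta>) = (\<integral>y. indicator X0 y *\<^sub>R push_fun \<gamma> \<zeta> y \<partial>N)"
    using X0 by (subst integral_restrict_space) (auto simp: N)
  also have "\<dots> = (\<integral>y. indicator (g ` K) y *\<^sub>R push_fun \<gamma> \<zeta> y \<partial>N)"
    using push_zero gK(2) \<gamma>(2) by (intro Bochner_Integration.integral_cong) (auto simp: indicator_def)
  also have "\<dots> = integral\<^sup>L (restrict_space N (g ` K)) (push_fun \<gamma> \<zeta>)"
    using meas by (subst integral_restrict_space) (auto simp: N)
  \<comment> \<open>A Borel set in the image of \<open>K\<close> is the image of its preimage in
    \<open>K\<close>, so \<open>inv\<close> identifies the two measures.\<close>
  also have "restrict_space N (g ` K) = distr (restrict_space N K) (restrict_space N (g ` K)) g"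
  proof (rule measure_eqI)
    fix B assume "B \<in> sets (restrict_space N (g ` K))"
    then have B: "B \<in> sets borel" "B \<subseteq> g ` K"
      using meas by (auto simp: sets_restrict_space_iff N)
    define A where "A = g -` B \<inter> K"
    have gA: "g ` A = B"
      using B by (auto simp: A_def)
    have "A \<in> sets borel"
      using measurable_sets[OF g_meas \<open>B \<in> sets (restrict_space N (g ` K))\<close>] meas
      by (auto simp: A_def space_restrict_space sets_restrict_space_iff N)
    then have "emeasure N B = emeasure N A"
      using inv[of A] B gA by (auto simp: A_def K_def g_def)
    then show "emeasure (restrict_space N (g ` K)) B =
        emeasure (distr (restrict_space N K) (restrict_space N (g ` K)) g) B"
      using B meas g_meas \<open>B \<in> sets (restrict_space N (g ` K))\<close>
      by (simp add: emeasure_distr emeasure_restrict_space N A_def space_restrict_space)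
  qed simp
  also have "integral\<^sup>L (distr (restrict_space N K) (restrict_space N (g ` K)) g) (push_fun \<gamma> \<zeta>) =
      (\<integral>x. push_fun \<gamma> \<zeta> (g x) \<partial>restrict_space N K)"
    by (rule integral_distr[OF g_meas push_meas])
  also have "\<dots> = integral\<^sup>L (restrict_space N K) \<zeta>"
    using K(2) by (intro Bochner_Integration.integral_cong) (simp_all add: space_restrict_space push hg subsetD)
  also have "\<dots> = (\<integral>x. indicator K x *\<^sub>R \<zeta> x \<partial>N)"
    using meas by (subst integral_restrict_space) (auto simp: N)
  also have "\<dots> = (\<integral>x. indicator X0 x *\<^sub>R \<zeta> x \<partial>N)"
    using zero K(3) by (intro Bochner_Integration.integral_cong) (auto simp: indicator_def)
  also have "\<dots> = integral\<^sup>L (restrict_space N X0) \<zeta>"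
    using X0 by (subst integral_restrict_space) (auto simp: N)
  finally show ?thesis .
qed

end

section \<open>The invariant measure\<close>

theorem theorem2:
  fixes \<Gamma> :: "('a::metric_space \<rightharpoonup> 'a) set" and X0 :: "'a set"
  assumes "locally compact (UNIV :: 'a set)"
    and "pseudo_star_group \<Gamma>" and "minimal_pg \<Gamma>" and "equicontinuous_pg \<Gamma>"
    and "open X0" and "X0 \<noteq> {}" and "compact (closure X0)"
  shows "\<exists>M. radon_measure_on X0 M \<and> emeasure M X0 < \<infinity> \<and> emeasure M X0 \<noteq> 0 \<and>
             invariant_measure {\<gamma>\<in>\<Gamma>. dom \<gamma> \<union> ran \<gamma> \<subseteq> X0} X0 M"
proof -
  note lc = assms(1) and psg = assms(2) and X0 = assms(5-7)
  let ?\<Delta> = "{\<gamma>\<in>\<Gamma>. dom \<gamma> \<union> ran \<gamma> \<subseteq> X0}"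
  obtain x0 where x0: "x0 \<in> X0"
    using X0 by blast
  \<comment> \<open>\<open>K0\<close> normalises the content and, lying in \<open>X0\<close>, makes
    the measure nonzero; its open part \<open>U0\<close> then has finite content and feeds the
    minimality argument.\<close>
  obtain U0 K0 where K0: "open U0" "compact K0" "{x0} \<subseteq> U0" "U0 \<subseteq> K0" "K0 \<subseteq> X0"
    using locally_compact_UNIV_compact_neighbourhood[OF lc, of "{x0}" X0] X0 x0 by auto
  obtain \<kappa> where \<kappa>: "metric_content \<kappa>" "\<kappa> K0 = 1"
    and \<kappa>_le: "\<And>\<gamma> K A. \<lbrakk>\<gamma> \<in> \<Gamma>; compact K; K \<subseteq> dom \<gamma>; A \<subseteq> K\<rbrakk> \<Longrightarrow> \<kappa> ((\<lambda>x. the (\<gamma> x)) ` A) \<le> \<kappa> A"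
    by (rule invariant_metric_content[OF psg assms(4) K0(2)]) (use K0(3,4) in auto)
  have "\<kappa> U0 \<le> 1"
    using metric_content.content_mono[OF \<kappa>(1) K0(4)] \<kappa>(2) by simp
  then have U0: "\<kappa> U0 < \<infinity>" "U0 \<noteq> {}"
    using K0(3) by (auto intro: le_less_trans)
  have \<kappa>_fin: "\<kappa> (closure X0) < \<infinity>"
    by (rule invariant_content_finite[OF psg lc assms(3) \<kappa>(1) _ K0(1) U0(2,1) X0(3)]) (rule \<kappa>_le)
  interpret \<kappa>: metric_content \<kappa> by (rule \<kappa>(1))
  \<comment> \<open>Truncation to \<open>X0\<close> bounds the total content by that of the compact
    closure, so the Borel measure on the whole space is finite.\<close>
  define \<kappa>0 where "\<kappa>0 A = \<kappa> (A \<inter> X0)" for A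
  interpret \<kappa>0: metric_content \<kappa>0
  proof
    show "\<kappa>0 (A \<union> B) \<le> \<kappa>0 A + \<kappa>0 B" for A B
      unfolding \<kappa>0_def Int_Un_distrib2 by (rule \<kappa>.content_subadditive)
    show "\<kappa>0 A + \<kappa>0 B \<le> \<kappa>0 (A \<union> B)"
      if "0 < e" "\<And>a b. a \<in> A \<Longrightarrow> b \<in> B \<Longrightarrow> e \<le> dist a b" for A B and e :: real
      unfolding \<kappa>0_def Int_Un_distrib2 using that
      by (intro \<kappa>.content_superadditive_separated[of e]) auto
  qed (auto simp: \<kappa>0_def \<kappa>.content_empty intro: \<kappa>.content_mono)
  define N where "N = \<kappa>0.borel_measure"
  define M where "M = restrict_space N X0"
  have sets_N: "sets N = sets borel" and space_N: "space N = UNIV"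
    by (simp_all add: N_def)
  have X0_borel: "X0 \<in> sets borel"
    using X0 by simp
  have sets_M: "sets M = sets (restrict_space borel X0)"
    by (simp add: M_def sets_restrict_space sets_N)
  have M_iff: "A \<in> sets M \<longleftrightarrow> A \<subseteq> X0 \<and> A \<in> sets borel" for A
    using X0_borel by (auto simp: M_def sets_restrict_space_iff sets_N space_N)
  have emeasure_M: "emeasure M A = emeasure N A" if "A \<subseteq> X0" for A
    using that X0_borel by (simp add: M_def emeasure_restrict_space sets_N space_N)
  have N_fin: "emeasure N UNIV < \<infinity>"
  proof -
    have "emeasure N UNIV \<le> \<kappa>0 UNIV"
      by (simp add: N_def \<kappa>0.emeasure_borel_measure \<kappa>0.outer_le_content)
    also have "\<dots> \<le> \<kappa> (closure X0)"
      using closure_subset by (auto simp: \<kappa>0_def intro: \<kappa>.content_mono)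
    finally show ?thesis
      using \<kappa>_fin by (rule le_less_trans)
  qed
  have M_fin: "emeasure M X0 < \<infinity>"
    using emeasure_mono[of X0 UNIV N] N_fin by (auto simp: emeasure_M sets_N intro: le_less_trans)
  \<comment> \<open>The outer measure could a priori lose all the mass; on the compact set
    \<open>K0\<close> it stays above the content.\<close>
  have "1 = \<kappa>0 K0"
    using K0(5) \<kappa>(2) by (simp add: \<kappa>0_def Int_absorb2)
  also have "\<dots> \<le> \<kappa>0.outer K0"
    by (rule \<kappa>0.content_le_outer[OF K0(2)])
  also have "\<dots> \<le> \<kappa>0.outer X0"
    by (rule \<kappa>0.mono[OF K0(5)])
  also have "\<dots> = emeasure M X0"
    using X0_borel by (simp add: emeasure_M N_def \<kappa>0.emeasure_borel_measure)
  finally have M_nz: "emeasure M X0 \<noteq> 0"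
    by auto
  have radon: "radon_measure_on X0 M"
    unfolding radon_measure_on_def
  proof (intro conjI ballI)
    show "\<exists>U. open U \<and> x \<in> U \<and> emeasure M (U \<inter> X0) < \<infinity>" for x
      using M_fin by (intro exI[of _ UNIV]) simp
    fix A assume "A \<in> sets M"
    then have A: "A \<subseteq> X0" "A \<in> sets borel"
      by (simp_all add: M_iff)
    \<comment> \<open>Inner regularity of \<open>N\<close> applies with the closure of
      \<open>X0\<close> as the ambient compact set.\<close>
    have "emeasure M A = (SUP K\<in>{K. compact K \<and> K \<subseteq> A}. emeasure N K)"
      using A X0(3) closure_subset[of X0] N_fin \<kappa>0.inner_regular[of A "closure X0"]
      by (simp add: emeasure_M N_def order_trans)
    also have "\<dots> = (SUP K\<in>{K. compact K \<and> K \<subseteq> A}. emeasure M K)"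
      using A by (intro SUP_cong) (auto intro!: emeasure_M[symmetric])
    finally show "emeasure M A = (SUP K\<in>{K. compact K \<and> K \<subseteq> A}. emeasure M K)" .
    show "emeasure M A = (INF U\<in>{U. open U \<and> A \<subseteq> U}. emeasure M (U \<inter> X0))"
    proof (rule antisym)
      show "emeasure M A \<le> (INF U\<in>{U. open U \<and> A \<subseteq> U}. emeasure M (U \<inter> X0))"
        using A X0_borel by (intro INF_greatest emeasure_mono) (auto simp: M_iff)
      have "(INF U\<in>{U. open U \<and> A \<subseteq> U}. emeasure M (U \<inter> X0)) \<le> (INF U\<in>{U. open U \<and> A \<subseteq> U}. emeasure N U)"
        by (rule INF_mono) (auto simp: emeasure_M sets_N intro!: emeasure_mono)
      also have "\<dots> = emeasure M A"
        using \<kappa>0.outer_regular[OF A(2)] A(1) by (simp add: emeasure_M N_def)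
      finally show "(INF U\<in>{U. open U \<and> A \<subseteq> U}. emeasure M (U \<inter> X0)) \<le> emeasure M A" .
    qed
  qed (rule sets_M)
  \<comment> \<open>The content is controlled only inside compact subsets of
    \<open>dom \<gamma>\<close>, while covers use arbitrary open sets. Intersecting each cover
    member with a neighbourhood \<open>V\<close> of \<open>K\<close> inside a compact
    \<open>L\<close> reconciles the two; the images are open and cover the image of
    \<open>A\<close>.\<close>
  have outer_le: "\<kappa>0.outer ((\<lambda>x. the (\<gamma> x)) ` A) \<le> \<kappa>0.outer A"
    if \<gamma>: "\<gamma> \<in> ?\<Delta>" and K: "compact K" "K \<subseteq> dom \<gamma>" "A \<subseteq> K" for \<gamma> K A
  proof (rule \<kappa>0.outer_geI)
    fix U :: "nat \<Rightarrow> 'a set"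
    assume U: "\<And>i. open (U i)" "A \<subseteq> (\<Union>i. U i)"
    have \<gamma>': "\<gamma> \<in> \<Gamma>" "local_homeo \<gamma>" "local_homeo (map_inv \<gamma>)"
      using \<gamma> psg_local_homeo[OF psg] psg_map_inv[OF psg] by auto
    obtain V L where VL: "open V" "compact L" "K \<subseteq> V" "V \<subseteq> L" "L \<subseteq> dom \<gamma>"
      using locally_compact_UNIV_compact_neighbourhood[OF lc K(1,2)] \<gamma>'(2)
      by (auto simp: local_homeo_def)
    have "\<kappa>0.outer ((\<lambda>x. the (\<gamma> x)) ` A) \<le> (\<Sum>i. \<kappa>0 ((\<lambda>x. the (\<gamma> x)) ` (U i \<inter> V)))"
    proof (rule \<kappa>0.outer_le)
      show "open ((\<lambda>x. the (\<gamma> x)) ` (U i \<inter> V))" for i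
        using U VL by (intro local_homeo_open_image[OF \<gamma>'(2,3)]) auto
      show "(\<lambda>x. the (\<gamma> x)) ` A \<subseteq> (\<Union>i. (\<lambda>x. the (\<gamma> x)) ` (U i \<inter> V))"
        unfolding image_UN[symmetric] using U(2) VL(3) K(3) by (intro image_mono) auto
    qed
    also have "\<dots> \<le> (\<Sum>i. \<kappa>0 (U i))"
    proof (intro suminf_le)
      fix i
      have "\<kappa>0 ((\<lambda>x. the (\<gamma> x)) ` (U i \<inter> V)) \<le> \<kappa> ((\<lambda>x. the (\<gamma> x)) ` (U i \<inter> V))"
        unfolding \<kappa>0_def by (rule \<kappa>.content_mono) auto
      also have "\<dots> \<le> \<kappa> (U i \<inter> V)"
        using \<gamma>'(1) VL by (intro \<kappa>_le[of _ L]) auto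
      \<comment> \<open>Here \<open>dom \<gamma> \<subseteq> X0\<close> enters: \<open>V\<close>
        lies in \<open>X0\<close>, so truncation loses nothing.\<close>
      also have "\<dots> \<le> \<kappa>0 (U i)"
        unfolding \<kappa>0_def using \<gamma> VL by (intro \<kappa>.content_mono) blast
      finally show "\<kappa>0 ((\<lambda>x. the (\<gamma> x)) ` (U i \<inter> V)) \<le> \<kappa>0 (U i)" .
    qed auto
    finally show "\<kappa>0.outer ((\<lambda>x. the (\<gamma> x)) ` A) \<le> (\<Sum>i. \<kappa>0 (U i))" .
  qed
  have \<Delta>_inv: "map_inv \<gamma> \<in> ?\<Delta>" if "\<gamma> \<in> ?\<Delta>" for \<gamma>
    using that psg_map_inv[OF psg] ran_map_inv[OF psg_local_homeo[OF psg]]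
    by (auto simp: dom_map_inv)
  have "invariant_measure ?\<Delta> X0 M"
    unfolding invariant_measure_def
  proof (intro ballI impI)
    fix \<gamma> \<zeta>
    assume \<gamma>: "\<gamma> \<in> ?\<Delta>" and \<zeta>: "\<zeta> \<in> Cc_on X0" "supp_on X0 \<zeta> \<subseteq> dom \<gamma>"
    show "integral\<^sup>L M (push_fun \<gamma> \<zeta>) = integral\<^sup>L M \<zeta>"
      unfolding M_def
    proof (rule integral_push_fun_eq[OF psg _ _ \<zeta> sets_N X0_borel])
      fix A assume A: "A \<in> sets borel" "A \<subseteq> supp_on X0 \<zeta>" "(\<lambda>x. the (\<gamma> x)) ` A \<in> sets borel"
      have "\<kappa>0.outer ((\<lambda>x. the (\<gamma> x)) ` A) = \<kappa>0.outer A"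
      proof (rule image_invariant_if_nonincreasing[where \<Delta>="?\<Delta>" and K="supp_on X0 \<zeta>", OF psg])
        show "\<kappa>0.outer ((\<lambda>x. the (\<gamma>' x)) ` B) \<le> \<kappa>0.outer B"
          if "\<gamma>' \<in> ?\<Delta>" "compact K" "K \<subseteq> dom \<gamma>'" "B \<subseteq> K" for \<gamma>' K B
          by (rule outer_le[OF that])
        show "map_inv \<gamma>' \<in> ?\<Delta>" if "\<gamma>' \<in> ?\<Delta>" for \<gamma>'
          by (rule \<Delta>_inv[OF that])
        show "compact (supp_on X0 \<zeta>)"
          using \<zeta>(1) by (simp add: Cc_on_def)
      qed (use \<gamma> \<zeta>(2) A(2) in auto)
      then show "emeasure N ((\<lambda>x. the (\<gamma> x)) ` A) = emeasure N A"
        using A by (simp add: N_def \<kappa>0.emeasure_borel_measure)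
    qed (use \<gamma> in auto)
  qed
  with radon M_fin M_nz show ?thesis
    by blast
qed

end
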